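(* Let $\varphi(z)=1+B_1z+B_2z^2+B_3z^3+\cdots$ be a Ma–Minda function, let $f\in\mathscr{S}^*(\varphi)$, and let $f^{-1}(\omega)=\omega+\sum_{n=2}^{\infty}A_n\omega^n$ for all $\omega$ in some neighbourhood of the origin. 1. If $B_1,B_2,B_3$ satisfy the conditions $$|3B_1^2-B_2|\leq B_1,\qquad \left|5B_1^4-6B_1^2B_2-3B_2^2+4B_1B_3\right|-3B_1^2\leq 0,$$ then $$|A_2A_4-A_3^2|\leq\frac{B_1^2}{4}.$$ 2. If $B_1,B_2,B_3$ satisfy the conditions $$|3B_1^2-B_2|\geq B_1,\qquad \left|5B_1^4-6B_1^2B_2-3B_2^2+4B_1B_3\right|-B_1\left|3B_1^2-B_2\right|-2B_1^2\geq 0,$$ or the conditions $$|3B_1^2-B_2|\leq B_1,\qquad \left|5B_1^4-6B_1^2B_2-3B_2^2+4B_1B_3\right|-3B_1^2\geq 0,$$ then $$|A_2A_4-A_3^2|\leq\frac{1}{12}\left|5B_1^4-6B_1^2B_2-3B_2^2+4B_1B_3\right|.$$ 3. If $B_1,B_2,B_3$ satisfy the conditions $$|3B_1^2-B_2|> B_1,\qquad \left|5B_1^4-6B_1^2B_2-3B_2^2+4B_1B_3\right|-B_1\left|3B_1^2-B_2\right|-2B_1^2\leq 0,$$ then $$|A_2A_4-A_3^2|\leq\frac{B_1^2}{12}\left(\frac{3\left|5B_1^4-6B_1^2B_2-3B_2^2+4B_1B_3\right|-4B_1\left|3B_1^2-B_2\right|-(3B_1^2-B_2)^2-4B_1^2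}{\left|5B_1^4-6B_1^2B_2-3B_2^2+4B_1B_3\right|-2B_1\left|3B_1^2-B_2\right|-B_1^2}\right).$$
   Context: $\mathbb{D}=\{z\in\mathbb{C}:|z|<1\}$. $\mathscr{A}$ is the class of functions $f$ analytic in $\mathbb{D}$ with $f(0)=0$, $f'(0)=1$. For analytic $F,G:\mathbb{D}\to\mathbb{C}$, $F\prec G$ (subordination) means that $F(z)=G(w(z))$ in $\mathbb{D}$ for some analytic $w:\mathbb{D}\to\mathbb{D}$ with $w(0)=0$. A Ma–Minda function $\varphi$ is a function analytic and univalent in $\mathbb{D}$ with positive real part, such that $\varphi(0)=1$, $\varphi'(0)>0$, and $\varphi(\mathbb{D})$ is symmetric with respect to the real axis and starlike with respect to $\varphi(0)=1$; its Taylor coefficients are denoted $\varphi(z)=1+B_1z+B_2z^2+B_3z^3+\cdots$ (so $B_1>0$). The class $\mathscr{S}^*(\varphi)$ is $\{f\in\mathscr{A}: zf'(z)/f(z)\prec\varphi(z)\}$, where $zf'(z)/f(z)$ is given the value $1$ at $z=0$. $f^{-1}$ denotes the local inverse of $f$ near the origin with $f^{-1}(0)=0$. *)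

theory Defs
  imports "HOL-Complex_Analysis.Complex_Analysis"
begin

abbreviation unit_disc :: "complex set" where
  "unit_disc \<equiv> ball 0 1"

definition class_A :: "(complex \<Rightarrow> complex) set" where
  "class_A = {f. f holomorphic_on unit_disc \<and> f 0 = 0 \<and> deriv f 0 = 1}"

definition subordinate :: "(complex \<Rightarrow> complex) \<Rightarrow> (complex \<Rightarrow> complex) \<Rightarrow> bool" where
  "subordinate F G \<longleftrightarrow> F holomorphic_on unit_disc \<and> G holomorphic_on unit_disc \<and>
     (\<exists>w. w holomorphic_on unit_disc \<and> w ` unit_disc \<subseteq> unit_disc \<and> w 0 = 0 \<and>
          (\<forall>z\<in>unit_disc. F z = G (w z)))"

definition starlike_wrt :: "complex set \<Rightarrow> complex \<Rightarrow> bool" where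
  "starlike_wrt S a \<longleftrightarrow> a \<in> S \<and> (\<forall>x\<in>S. closed_segment a x \<subseteq> S)"

definition ma_minda :: "(complex \<Rightarrow> complex) \<Rightarrow> bool" where
  "ma_minda \<phi> \<longleftrightarrow>
     \<phi> holomorphic_on unit_disc \<and> inj_on \<phi> unit_disc \<and>
     (\<forall>z\<in>unit_disc. Re (\<phi> z) > 0) \<and>
     \<phi> 0 = 1 \<and> deriv \<phi> 0 \<in> \<real> \<and> Re (deriv \<phi> 0) > 0 \<and>
     cnj ` \<phi> ` unit_disc = \<phi> ` unit_disc \<and>
     starlike_wrt (\<phi> ` unit_disc) 1"

text \<open>
  The symmetry of \<open>\<phi>(\<D>)\<close> and \<open>\<phi>'(0) > 0\<close> force \<open>\<phi>\<close> to commute with conjugation, so the Taylor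
  coefficients are real. Taking them as a real sequence is therefore no extra assumption.
\<close>

lemma ma_minda_cnj:
  assumes "ma_minda \<phi>" and z: "z \<in> unit_disc"
  shows "\<phi> (cnj z) = cnj (\<phi> z)"
proof -
  have hol: "\<phi> holomorphic_on unit_disc" and inj: "inj_on \<phi> unit_disc"
    and \<phi>0: "\<phi> 0 = 1" and d0: "deriv \<phi> 0 \<in> \<real>" "deriv \<phi> 0 \<noteq> 0"
    and sym: "cnj ` \<phi> ` unit_disc = \<phi> ` unit_disc"
    using assms by (auto simp: ma_minda_def)
  obtain \<psi> where \<psi>: "\<psi> holomorphic_on (\<phi> ` unit_disc)"
    "\<And>z. z \<in> unit_disc \<Longrightarrow> deriv \<phi> z * deriv \<psi> (\<phi> z) = 1"
    "\<And>z. z \<in> unit_disc \<Longrightarrow> \<psi> (\<phi> z) = z"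
    using holomorphic_has_inverse[OF hol open_ball inj] by metis
  define k where "k = cnj \<circ> \<phi> \<circ> cnj"
  have cnj_disc: "cnj ` unit_disc = unit_disc"
    by (auto simp: image_iff intro!: bexI[of _ "cnj x" for x])
  have k_hol: "k holomorphic_on unit_disc"
    unfolding k_def using hol by (intro holomorphic_on_compose_cnj_cnj) (auto simp: cnj_disc)
  have k_mem: "k z \<in> \<phi> ` unit_disc" if "z \<in> unit_disc" for z
  proof -
    have "cnj (\<phi> (cnj z)) \<in> cnj ` \<phi> ` unit_disc" using that by (intro imageI) auto
    then show ?thesis unfolding sym by (simp add: k_def)
  qed
  define h where "h = \<psi> \<circ> k"
  have h_hol: "h holomorphic_on unit_disc"
    unfolding h_def using k_mem by (intro holomorphic_on_compose_gen[OF k_hol \<psi>(1)]) auto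
  have \<phi>h: "h z \<in> unit_disc" "\<phi> (h z) = k z" if z: "z \<in> unit_disc" for z
  proof -
    obtain x where "x \<in> unit_disc" "k z = \<phi> x" using k_mem[OF z] by auto
    then show "h z \<in> unit_disc" "\<phi> (h z) = k z" by (simp_all add: h_def \<psi>(3))
  qed
  have k0: "k 0 = 1" by (simp add: k_def \<phi>0)
  have h0: "h 0 = 0" using \<psi>(3)[of 0] by (simp add: h_def k0 \<phi>0)
  have "(\<phi> has_field_derivative deriv \<phi> 0) (at (cnj 0))"
    using hol by (simp add: holomorphic_derivI)
  then have dk: "(k has_field_derivative deriv \<phi> 0) (at 0)"
    using has_field_derivative_cnj_cnj[of \<phi> "deriv \<phi> 0" 0] d0(1)
    by (simp add: k_def Reals_cnj_iff)
  have "(\<phi> \<circ> h has_field_derivative deriv \<phi> 0 * deriv h 0) (at 0)"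
    by (rule DERIV_chain) (use hol h_hol h0 in \<open>auto intro!: holomorphic_derivI[of _ unit_disc]\<close>)
  then have "(k has_field_derivative deriv \<phi> 0 * deriv h 0) (at 0)"
    by (rule has_field_derivative_transform_within_open[of _ _ _ unit_disc]) (auto simp: \<phi>h)
  from DERIV_unique[OF dk this] have dh: "deriv h 0 = 1" using d0 by simp
  obtain \<alpha> where \<alpha>: "\<And>z. norm z < 1 \<Longrightarrow> h z = \<alpha> * z"
    using Schwarz_Lemma(3)[OF h_hol h0, of 0] \<phi>h(1) dh by auto
  have "(h has_field_derivative \<alpha>) (at 0)"
    by (rule has_field_derivative_transform_within_open[of "\<lambda>z. \<alpha> * z" _ _ unit_disc])
       (auto simp: \<alpha> intro!: derivative_eq_intros)
  with dh have "\<alpha> = 1" by (simp add: DERIV_imp_deriv)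
  with \<alpha>[of "z"] \<phi>h(2)[of "z"] z have "\<phi> z = cnj (\<phi> (cnj z))" by (simp add: k_def)
  then show ?thesis by (metis complex_cnj_cnj)
qed

lemma ma_minda_real_coefficients:
  assumes "ma_minda \<phi>"
  shows "\<exists>B :: nat \<Rightarrow> real. \<forall>z\<in>unit_disc.
           (\<lambda>n. complex_of_real (B (n + 1)) * z ^ (n + 1)) sums (\<phi> z - 1)"
proof (intro exI[of _ "\<lambda>n. Re ((deriv ^^ n) \<phi> 0 / fact n)"] ballI)
  fix z assume z: "z \<in> unit_disc"
  define c where "c n = (deriv ^^ n) \<phi> 0 / fact n" for n
  have hol: "\<phi> holomorphic_on unit_disc" and \<phi>0: "\<phi> 0 = 1"
    using assms by (auto simp: ma_minda_def)
  have s: "(\<lambda>n. c n * x ^ n) sums \<phi> x" if "x \<in> unit_disc" for x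
    using holomorphic_power_series[OF hol that] by (simp add: c_def)
  have "(\<lambda>n. cnj (c n * cnj z ^ n)) sums cnj (\<phi> (cnj z))"
    unfolding sums_cnj using z by (intro s) auto
  then have "(\<lambda>n. cnj (c n) * z ^ n) sums \<phi> z"
    using ma_minda_cnj[OF assms z] by simp
  from sums_divide[OF sums_add[OF s[OF z] this], of 2]
  have "(\<lambda>n. (c n + cnj (c n)) / 2 * z ^ n) sums \<phi> z"
    by (simp add: algebra_simps add_divide_distrib)
  then have "(\<lambda>n. complex_of_real (Re (c n)) * z ^ n) sums \<phi> z"
    by (simp add: complex_add_cnj)
  then show "(\<lambda>n. complex_of_real (Re ((deriv ^^ (n + 1)) \<phi> 0 / fact (n + 1))) * z ^ (n + 1))
               sums (\<phi> z - 1)"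
    unfolding c_def[symmetric]
    using sums_Suc_iff[of "\<lambda>n. complex_of_real (Re (c n)) * z ^ n" "\<phi> z - 1"]
    by (simp add: c_def \<phi>0)
qed

text \<open>
  Total division is harmless below: if \<open>f z = 0\<close> for some \<open>z \<noteq> 0\<close> in the disc, the quotient
  is \<open>0\<close> there, which is not a value of a Ma-Minda function \<open>\<phi>\<close>. So the members of the class
  vanish only at the origin.
\<close>

definition starlike_class :: "(complex \<Rightarrow> complex) \<Rightarrow> (complex \<Rightarrow> complex) set" where
  "starlike_class \<phi> =
     {f \<in> class_A. subordinate (\<lambda>z. if z = 0 then 1 else z * deriv f z / f z) \<phi>}"

definition local_inverse_at_0 :: "(complex \<Rightarrow> complex) \<Rightarrow> (complex \<Rightarrow> complex) \<Rightarrow> bool" where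
  "local_inverse_at_0 f g \<longleftrightarrow> g 0 = 0 \<and>
     (\<forall>\<^sub>F w in nhds 0. f (g w) = w) \<and> (\<forall>\<^sub>F z in nhds 0. g (f z) = z)"

end

theory Submission
  imports Defs
begin

text \<open>
  Write \<open>z f'(z) / f(z) = \<phi>(w(z))\<close> with a Schwarz function
  \<open>w(z) = c\<^sub>1 z + c\<^sub>2 z\<^sup>2 + c\<^sub>3 z\<^sup>3 + \<dots>\<close>, and put \<open>Q = 3 B\<^sub>1\<^sup>2 - B\<^sub>2\<close> and
  \<open>T = 5 B\<^sub>1\<^sup>4 - 6 B\<^sub>1\<^sup>2 B\<^sub>2 - 3 B\<^sub>2\<^sup>2 + 4 B\<^sub>1 B\<^sub>3\<close>. Comparing coefficients in \<open>z f' = f \<cdot> (\<phi> \<circ> w)\<close> and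
  in \<open>f \<circ> f\<^sup>-\<^sup>1 = id\<close> turns the Hankel determinant into
  \<open>12 (A\<^sub>2 A\<^sub>4 - A\<^sub>3\<^sup>2) = T c\<^sub>1\<^sup>4 - 2 B\<^sub>1 Q c\<^sub>1\<^sup>2 c\<^sub>2 + 4 B\<^sub>1\<^sup>2 c\<^sub>1 c\<^sub>3 - 3 B\<^sub>1\<^sup>2 c\<^sub>2\<^sup>2\<close>.

  Three steps of Schur's algorithm parametrise the coefficients of a Schwarz function: there are
  \<open>x\<close> and \<open>y\<close> in the closed disc with \<open>c\<^sub>2 = (1 - |c\<^sub>1|\<^sup>2) x\<close> and
  \<open>c\<^sub>3 = (1 - |c\<^sub>1|\<^sup>2) ((1 - |x|\<^sup>2) y - cnj c\<^sub>1 x\<^sup>2)\<close>. After the triangle inequality the bound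
  on the determinant is nondecreasing in \<open>|x|\<close>, because the coefficient of \<open>|x|\<^sup>2\<close> is
  \<open>B\<^sub>1\<^sup>2 (1 - |c\<^sub>1|\<^sup>2) (1 - |c\<^sub>1|) (3 - |c\<^sub>1|) \<ge> 0\<close>. Setting \<open>|x| = 1\<close> leaves the
  quadratic \<open>|T| s\<^sup>2 + 2 B\<^sub>1 |Q| s (1 - s) + B\<^sub>1\<^sup>2 (1 - s) (3 + s)\<close> in \<open>s = |c\<^sub>1|\<^sup>2 \<in> [0, 1]\<close>.
  The three cases of the theorem are those in which this quadratic is bounded by its value at
  \<open>s = 0\<close>, by its value at \<open>s = 1\<close>, and by the value at its vertex.
\<close>

unbundle no vec_syntax
unbundle fps_syntax

section \<open>Coefficients of Schwarz functions\<close>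

text \<open>
  One step of Schur's algorithm: \<open>x\<close> is the quotient by \<open>z\<close> of the Moebius transform
  \<open>(h - h 0) / (1 - cnj (h 0) * h)\<close>, which the Schwarz lemma bounds. Clearing the denominator
  makes the relation meaningful also when \<open>h\<close> is a unimodular constant, where \<open>x = 0\<close> serves.
\<close>

lemma schur_step:
  assumes holo: "h holomorphic_on ball 0 1"
    and le1: "\<And>z. norm z < 1 \<Longrightarrow> norm (h z) \<le> 1"
  obtains x where "x holomorphic_on ball 0 1" "\<And>z. norm z < 1 \<Longrightarrow> norm (x z) \<le> 1"
    "\<And>z. norm z < 1 \<Longrightarrow> h z - h 0 = z * x z * (1 - cnj (h 0) * h z)"
proof (cases "\<exists>\<xi>. norm \<xi> < 1 \<and> norm (h \<xi>) = 1")
  case True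
  then obtain \<xi> where \<xi>: "norm \<xi> < 1" "norm (h \<xi>) = 1" by auto
  have "h constant_on ball 0 1"
    by (rule maximum_modulus_principle[OF holo, of "ball 0 1" \<xi>]) (use \<xi> le1 in auto)
  then obtain a where "\<And>z. z \<in> ball 0 1 \<Longrightarrow> h z = a"
    by (auto simp: constant_on_def)
  then have const: "h z = h 0" if "norm z < 1" for z
    using that by simp
  show ?thesis
  proof (rule that[of "\<lambda>_. 0"])
    show "h z - h 0 = z * 0 * (1 - cnj (h 0) * h z)" if "norm z < 1" for z
      using const[OF that] by simp
  qed simp_all
next
  case False
  with le1 have lt1: "norm (h z) < 1" if "norm z < 1" for z
    using that by (metis order_le_less)
  define k where "k = Moebius_function 0 (h 0) \<circ> h"
  have h0: "norm (h 0) < 1" by (rule lt1) simp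
  have k_holo: "k holomorphic_on ball 0 1" unfolding k_def
    by (intro holomorphic_on_compose_gen[OF holo Moebius_function_holomorphic[OF h0]])
       (use lt1 in auto)
  have k_lt1: "norm (k z) < 1" if "norm z < 1" for z
    using Moebius_function_norm_lt_1[OF h0 lt1[OF that]] by (simp add: k_def)
  have k0: "k 0 = 0" by (simp add: k_def Moebius_function_eq_zero)
  obtain x where x: "x holomorphic_on ball 0 1" "\<And>z. norm z < 1 \<Longrightarrow> k z = z * x z"
      "deriv k 0 = x 0"
    by (rule Schwarz3[OF k_holo k0]) auto
  show ?thesis
  proof (rule that[OF x(1)])
    fix z :: complex assume z: "norm z < 1"
    show "norm (x z) \<le> 1"
    proof (cases "z = 0")
      case True
      then show ?thesis using Schwarz_Lemma(2)[OF k_holo k0 k_lt1 z] x(3) by simp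
    next
      case False
      have "norm z * norm (x z) \<le> norm z * 1"
        using Schwarz_Lemma(1)[OF k_holo k0 k_lt1 z] x(2)[OF z] by (simp add: norm_mult)
      then show ?thesis using False by (simp add: mult_le_cancel_left)
    qed
    have "norm (cnj (h 0) * h z) < 1"
      using norm_mult_less[of "cnj (h 0)" 1 "h z" 1] h0 lt1[OF z] by simp
    then have "1 - cnj (h 0) * h z \<noteq> 0" by force
    then show "h z - h 0 = z * x z * (1 - cnj (h 0) * h z)"
      using x(2)[OF z] by (simp add: k_def Moebius_function_simple divide_simps)
  qed
qed

lemma eventually_norm_less_1: "\<forall>\<^sub>F z in nhds (0::complex). norm z < 1"
  using eventually_nhds_in_open[of "ball 0 1" "0::complex"] by simp

lemma fps_expansion_eqI_eventually:
  fixes f g :: "complex \<Rightarrow> complex"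
  assumes "f has_fps_expansion F" "g has_fps_expansion G" "\<forall>\<^sub>F z in nhds 0. f z = g z"
  shows "F = G"
  using assms fps_expansion_unique_complex has_fps_expansion_cong by metis

lemma schur_step_fps:
  assumes holo: "h holomorphic_on ball 0 1"
    and le1: "\<And>z. norm z < 1 \<Longrightarrow> norm (h z) \<le> 1"
    and H: "h has_fps_expansion H"
  obtains x X where "x holomorphic_on ball 0 1" "\<And>z. norm z < 1 \<Longrightarrow> norm (x z) \<le> 1"
    "x has_fps_expansion X"
    "H - fps_const (H $ 0) = fps_X * X * (1 - fps_const (cnj (H $ 0)) * H)"
proof -
  have H0: "h 0 = H $ 0" using H by (rule has_fps_expansion_imp_0_eq_fps_nth_0)
  obtain x where x: "x holomorphic_on ball 0 1" "\<And>z. norm z < 1 \<Longrightarrow> norm (x z) \<le> 1"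
    "\<And>z. norm z < 1 \<Longrightarrow> h z - h 0 = z * x z * (1 - cnj (h 0) * h z)"
    using schur_step[OF holo le1] by blast
  have X: "x has_fps_expansion fps_expansion x 0"
    by (rule has_fps_expansion_fps_expansion[OF open_ball _ x(1)]) simp
  have "H - fps_const (H $ 0) =
      fps_X * fps_expansion x 0 * (1 - fps_const (cnj (H $ 0)) * H)"
  proof (rule fps_expansion_eqI_eventually)
    show "(\<lambda>z. h z - H $ 0) has_fps_expansion H - fps_const (H $ 0)"
      by (intro fps_expansion_intros H)
    show "(\<lambda>z. z * x z * (1 - cnj (H $ 0) * h z)) has_fps_expansion
        fps_X * fps_expansion x 0 * (1 - fps_const (cnj (H $ 0)) * H)"
      by (intro fps_expansion_intros H X)
    show "\<forall>\<^sub>F z in nhds 0. h z - H $ 0 = z * x z * (1 - cnj (H $ 0) * h z)"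
      using eventually_norm_less_1 by eventually_elim (use x(3) H0 in auto)
  qed
  with x X that show ?thesis by blast
qed

text \<open>
  The first Schur step divides \<open>w\<close> by \<open>z\<close>. The values at \<open>0\<close> of the three successive functions are
  the Schur parameters \<open>W $ 1\<close>, \<open>x\<close> and \<open>y\<close>, and the recursion is solved for \<open>W $ 2\<close> and \<open>W $ 3\<close>.
\<close>

lemma schwarz_function_coefficients:
  assumes holo: "w holomorphic_on ball 0 1" and w0: "w 0 = 0"
    and lt1: "\<And>z. norm z < 1 \<Longrightarrow> norm (w z) < 1"
    and W: "w has_fps_expansion W"
  obtains x y where "norm (W $ 1) \<le> 1" "norm x \<le> 1" "norm y \<le> 1"
    "W $ 2 = complex_of_real (1 - (cmod (W $ 1))\<^sup>2) * x"
    "W $ 3 = complex_of_real (1 - (cmod (W $ 1))\<^sup>2) *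
        (complex_of_real (1 - (cmod x)\<^sup>2) * y - cnj (W $ 1) * x\<^sup>2)"
proof -
  have W0: "W $ 0 = 0" using has_fps_expansion_imp_0_eq_fps_nth_0[OF W] w0 by simp
  obtain h H where h: "h holomorphic_on ball 0 1" "\<And>z. norm z < 1 \<Longrightarrow> norm (h z) \<le> 1"
      "h has_fps_expansion H" "W - fps_const (W $ 0) = fps_X * H * (1 - fps_const (cnj (W $ 0)) * W)"
    using schur_step_fps[OF holo less_imp_le[OF lt1] W] by blast
  obtain x X where x: "x holomorphic_on ball 0 1" "\<And>z. norm z < 1 \<Longrightarrow> norm (x z) \<le> 1"
      "x has_fps_expansion X" "H - fps_const (H $ 0) = fps_X * X * (1 - fps_const (cnj (H $ 0)) * H)"
    using schur_step_fps[OF h(1-3)] by blast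
  obtain y Y where y: "\<And>z. norm z < 1 \<Longrightarrow> norm (y z) \<le> 1"
      "y has_fps_expansion Y" "X - fps_const (X $ 0) = fps_X * Y * (1 - fps_const (cnj (X $ 0)) * X)"
    using schur_step_fps[OF x(1-3)] by blast
  have norms: "norm (H $ 0) \<le> 1" "norm (X $ 0) \<le> 1" "norm (Y $ 0) \<le> 1"
    using h(2)[of 0] x(2)[of 0] y(1)[of 0] h(3) x(3) y(2)
    by (simp_all add: has_fps_expansion_imp_0_eq_fps_nth_0)
  have W_eq: "W = fps_X * H" using h(4) W0 by simp
  have W_nth: "W $ 1 = H $ 0" "W $ 2 = H $ 1" "W $ 3 = H $ 2"
    by (simp_all add: W_eq)
  define c where "c = H $ 0"
  have sq: "complex_of_real (1 - (cmod u)\<^sup>2) = 1 - cnj u * u" for u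
    by (metis complex_norm_square mult.commute of_real_1 of_real_diff of_real_power)
  have H_eq: "H $ n = (fps_X * (X * (1 - fps_const (cnj c) * H))) $ n" if "n > 0" for n
    using arg_cong[OF x(4), of "\<lambda>F. F $ n"] that by (simp add: c_def mult.assoc)
  have X_eq: "X $ n = (fps_X * (Y * (1 - fps_const (cnj (X $ 0)) * X))) $ n" if "n > 0" for n
    using arg_cong[OF y(3), of "\<lambda>F. F $ n"] that by (simp add: mult.assoc)
  have H1: "H $ 1 = X $ 0 * (1 - cnj c * c)"
    by (subst H_eq) (simp_all add: c_def)
  have X1: "X $ 1 = Y $ 0 * (1 - cnj (X $ 0) * X $ 0)"
    by (subst X_eq) simp_all
  have H2: "H $ 2 = X $ 1 * (1 - cnj c * c) - X $ 0 * (cnj c * H $ 1)"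
    by (subst H_eq) (simp_all add: c_def)
  show ?thesis
  proof (rule that)
    show "norm (W $ 1) \<le> 1" "norm (X $ 0) \<le> 1" "norm (Y $ 0) \<le> 1"
      using norms W_nth by simp_all
    show "W $ 2 = complex_of_real (1 - (cmod (W $ 1))\<^sup>2) * X $ 0"
      by (simp only: sq W_nth H1 flip: c_def) (simp add: mult.commute)
    show "W $ 3 = complex_of_real (1 - (cmod (W $ 1))\<^sup>2) *
        (complex_of_real (1 - (cmod (X $ 0))\<^sup>2) * Y $ 0 - cnj (W $ 1) * (X $ 0)\<^sup>2)"
      unfolding sq W_nth H2 H1 X1 c_def[symmetric] by algebra
  qed
qed

section \<open>Comparison of coefficients\<close>

lemma fps_compose_nth_upto_4:
  fixes F G :: "'a :: comm_ring_1 fps"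
  assumes "G $ 0 = 0"
  shows "(F oo G) $ 1 = F $ 1 * G $ 1"
    and "(F oo G) $ 2 = F $ 1 * G $ 2 + F $ 2 * (G $ 1)\<^sup>2"
    and "(F oo G) $ 3 = F $ 1 * G $ 3 + 2 * F $ 2 * G $ 1 * G $ 2 + F $ 3 * (G $ 1) ^ 3"
    and "(F oo G) $ 4 = F $ 1 * G $ 4 + F $ 2 * ((G $ 2)\<^sup>2 + 2 * G $ 1 * G $ 3)
           + 3 * F $ 3 * (G $ 1)\<^sup>2 * G $ 2 + F $ 4 * (G $ 1) ^ 4"
  using assms
  by (simp_all add: fps_compose_nth fps_mult_nth eval_nat_numeral algebra_simps)

lemma starlike_coefficients:
  fixes F P :: "complex fps"
  assumes eq: "fps_X * fps_deriv F = F * P" and F: "F $ 0 = 0" "F $ 1 = 1" and P: "P $ 0 = 1"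
  shows "F $ 2 = P $ 1" and "F $ 3 = (P $ 2 + (P $ 1)\<^sup>2) / 2"
    and "F $ 4 = P $ 3 / 3 + P $ 1 * P $ 2 / 2 + (P $ 1) ^ 3 / 6"
proof -
  have nth: "of_nat n * F $ n = (F * P) $ n" for n
    using arg_cong[OF eq, of "\<lambda>F. F $ n"] by (cases n) simp_all
  show F2: "F $ 2 = P $ 1"
    using nth[of 2] F P by (simp add: fps_mult_nth eval_nat_numeral)
  have "2 * F $ 3 = P $ 2 + F $ 2 * P $ 1"
    using nth[of 3] F P by (simp add: fps_mult_nth eval_nat_numeral)
  then show F3: "F $ 3 = (P $ 2 + (P $ 1)\<^sup>2) / 2"
    by (simp add: F2 power2_eq_square field_simps)
  have "3 * F $ 4 = P $ 3 + F $ 2 * P $ 2 + F $ 3 * P $ 1"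
    using nth[of 4] F P by (simp add: fps_mult_nth eval_nat_numeral)
  then show "F $ 4 = P $ 3 / 3 + P $ 1 * P $ 2 / 2 + (P $ 1) ^ 3 / 6"
    unfolding F2 F3 by (simp add: field_simps power2_eq_square power3_eq_cube)
qed

lemma inverse_coefficients:
  fixes F G :: "complex fps"
  assumes FG: "F oo G = fps_X" and F: "F $ 1 = 1" and G: "G $ 0 = 0"
  shows "G $ 2 = - (F $ 2)" and "G $ 3 = 2 * (F $ 2)\<^sup>2 - F $ 3"
    and "G $ 4 = - 5 * (F $ 2) ^ 3 + 5 * F $ 2 * F $ 3 - F $ 4"
proof -
  note nth = fps_compose_nth_upto_4[OF G, of F, unfolded FG F]
  have G1: "G $ 1 = 1" using nth(1) by simp
  show G2: "G $ 2 = - (F $ 2)" using nth(2) G1 by (simp add: eq_neg_iff_add_eq_0)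
  show G3: "G $ 3 = 2 * (F $ 2)\<^sup>2 - F $ 3"
    using nth(3) G1 G2 by simp algebra
  show "G $ 4 = - 5 * (F $ 2) ^ 3 + 5 * F $ 2 * F $ 3 - F $ 4"
    using nth(4) G1 G2 G3 by simp algebra
qed

lemma inverse_hankel_determinant:
  fixes F G P \<Phi> W :: "complex fps"
  assumes eq: "fps_X * fps_deriv F = F * (\<Phi> oo W)" and F: "F $ 0 = 0" "F $ 1 = 1"
    and \<Phi>: "\<Phi> $ 0 = 1" and W: "W $ 0 = 0" and FG: "F oo G = fps_X" and G: "G $ 0 = 0"
  shows "12 * (G $ 2 * G $ 4 - (G $ 3)\<^sup>2) =
      (5 * (\<Phi> $ 1) ^ 4 - 6 * (\<Phi> $ 1)\<^sup>2 * \<Phi> $ 2 - 3 * (\<Phi> $ 2)\<^sup>2 + 4 * \<Phi> $ 1 * \<Phi> $ 3) * (W $ 1) ^ 4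
      - 2 * \<Phi> $ 1 * (3 * (\<Phi> $ 1)\<^sup>2 - \<Phi> $ 2) * (W $ 1)\<^sup>2 * W $ 2
      + 4 * (\<Phi> $ 1)\<^sup>2 * W $ 1 * W $ 3 - 3 * (\<Phi> $ 1)\<^sup>2 * (W $ 2)\<^sup>2"
proof -
  define P where "P = \<Phi> oo W"
  have P0: "P $ 0 = 1" using \<Phi> by (simp add: P_def)
  note P = fps_compose_nth_upto_4(1-3)[OF W, of \<Phi>, folded P_def]
  note F_nth = starlike_coefficients[OF eq[folded P_def] F P0]
  have "12 * (G $ 2 * G $ 4 - (G $ 3)\<^sup>2) =
      5 * (P $ 1) ^ 4 - 6 * (P $ 1)\<^sup>2 * P $ 2 + 4 * P $ 1 * P $ 3 - 3 * (P $ 2)\<^sup>2"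
    unfolding inverse_coefficients[OF FG F(2) G] F_nth
    by (simp add: field_simps power2_eq_square power3_eq_cube power4_eq_xxxx)
  then show ?thesis unfolding P
    by (simp add: algebra_simps power2_eq_square power3_eq_cube power4_eq_xxxx)
qed

section \<open>Estimates\<close>

text \<open>
  In the triangle inequality the factor \<open>1 - |x|\<^sup>2\<close> in front of \<open>y\<close> is kept exact, so that
  \<open>|x|\<close> can afterwards be raised to \<open>1\<close>.
\<close>

lemma hankel_quadratic_bound:
  fixes b T Q :: real and c x y :: complex
  assumes b: "b \<ge> 0" and c: "cmod c \<le> 1" and x: "cmod x \<le> 1" and y: "cmod y \<le> 1"
    and c2: "c2 = complex_of_real (1 - (cmod c)\<^sup>2) * x"
    and c3: "c3 = complex_of_real (1 - (cmod c)\<^sup>2) *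
        (complex_of_real (1 - (cmod x)\<^sup>2) * y - cnj c * x\<^sup>2)"
  defines "s \<equiv> (cmod c)\<^sup>2"
  shows "cmod (of_real T * c ^ 4 - 2 * of_real b * of_real Q * c\<^sup>2 * c2
        + 4 * (of_real b)\<^sup>2 * c * c3 - 3 * (of_real b)\<^sup>2 * c2\<^sup>2)
      \<le> \<bar>T\<bar> * s\<^sup>2 + 2 * b * \<bar>Q\<bar> * (s * (1 - s)) + b\<^sup>2 * ((1 - s) * (3 + s))"
proof -
  define p t where "p = cmod c" and "t = cmod x"
  have pt: "0 \<le> p" "p \<le> 1" "0 \<le> t" "t \<le> 1" using c x by (simp_all add: p_def t_def)
  have p2: "0 \<le> 1 - p\<^sup>2" "0 \<le> 1 - t\<^sup>2" using pt by (simp_all add: power_le_one)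
  have cc: "c * cnj c = of_real (p\<^sup>2)" by (simp only: p_def complex_norm_square)
  define u1 u2 u3 u4 where
    "u1 = complex_of_real T * c ^ 4"
    and "u2 = complex_of_real (2 * b * Q * (1 - p\<^sup>2)) * (c\<^sup>2 * x)"
    and "u3 = complex_of_real (4 * b\<^sup>2 * ((1 - p\<^sup>2) * (1 - t\<^sup>2))) * (c * y)"
    and "u4 = complex_of_real (b\<^sup>2 * ((1 - p\<^sup>2) * (3 + p\<^sup>2))) * x\<^sup>2"
  have "of_real T * c ^ 4 - 2 * of_real b * of_real Q * c\<^sup>2 * c2
        + 4 * (of_real b)\<^sup>2 * c * c3 - 3 * (of_real b)\<^sup>2 * c2\<^sup>2 = u1 - u2 + u3 - u4"
    unfolding c2 c3 u1_def u2_def u3_def u4_def p_def[symmetric] t_def[symmetric]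
    using cc by (simp, algebra)
  also have "cmod \<dots> \<le> cmod u1 + cmod u2 + cmod u3 + cmod u4"
    by (smt (verit) norm_triangle_ineq norm_triangle_ineq4)
  also have "cmod u1 = \<bar>T\<bar> * p ^ 4" by (simp add: u1_def norm_mult norm_power p_def)
  also have "cmod u2 = 2 * b * \<bar>Q\<bar> * (p\<^sup>2 * (1 - p\<^sup>2)) * t"
    unfolding u2_def using b p2
    by (simp only: norm_mult norm_power norm_of_real abs_mult flip: p_def t_def) simp
  also have "cmod u3 = 4 * b\<^sup>2 * ((1 - p\<^sup>2) * (1 - t\<^sup>2)) * (p * cmod y)"
    unfolding u3_def using b p2
    by (simp only: norm_mult norm_power norm_of_real abs_mult flip: p_def t_def) simp
  also have "cmod u4 = b\<^sup>2 * ((1 - p\<^sup>2) * (3 + p\<^sup>2)) * t\<^sup>2"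
    unfolding u4_def using b p2
    by (simp only: norm_mult norm_power norm_of_real abs_mult flip: p_def t_def) simp
  also have "4 * b\<^sup>2 * ((1 - p\<^sup>2) * (1 - t\<^sup>2)) * (p * cmod y)
      \<le> 4 * b\<^sup>2 * ((1 - p\<^sup>2) * (1 - t\<^sup>2)) * p"
    using mult_left_le[OF y pt(1)] p2 by (intro mult_left_mono) simp_all
  also have "2 * b * \<bar>Q\<bar> * (p\<^sup>2 * (1 - p\<^sup>2)) * t \<le> 2 * b * \<bar>Q\<bar> * (p\<^sup>2 * (1 - p\<^sup>2))"
    using pt p2 b by (intro mult_right_le_one_le) simp_all
  also have "\<bar>T\<bar> * p ^ 4 + 2 * b * \<bar>Q\<bar> * (p\<^sup>2 * (1 - p\<^sup>2))
      + 4 * b\<^sup>2 * ((1 - p\<^sup>2) * (1 - t\<^sup>2)) * p + b\<^sup>2 * ((1 - p\<^sup>2) * (3 + p\<^sup>2)) * t\<^sup>2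
    = \<bar>T\<bar> * p ^ 4 + 2 * b * \<bar>Q\<bar> * (p\<^sup>2 * (1 - p\<^sup>2)) + b\<^sup>2 * ((1 - p\<^sup>2) * (3 + p\<^sup>2))
      - b\<^sup>2 * ((1 - p\<^sup>2) * (1 - t\<^sup>2)) * ((1 - p) * (3 - p))"
    by algebra
  also have "\<dots> \<le> \<bar>T\<bar> * p ^ 4 + 2 * b * \<bar>Q\<bar> * (p\<^sup>2 * (1 - p\<^sup>2)) + b\<^sup>2 * ((1 - p\<^sup>2) * (3 + p\<^sup>2))"
    using pt p2 by simp
  finally show ?thesis by (simp add: s_def p_def)
qed

text \<open>
  The quadratic is nondecreasing in \<open>q\<close> and \<open>t\<close>, and for \<open>q = b\<close>, \<open>t = 3 b\<^sup>2\<close> it is the constant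
  \<open>3 b\<^sup>2\<close>.
\<close>

lemma quadratic_le_at_0:
  fixes b t q s :: real
  assumes "b > 0" "0 \<le> s" "s \<le> 1" "q \<le> b" "t \<le> 3 * b\<^sup>2"
  shows "t * s\<^sup>2 + 2 * b * q * (s * (1 - s)) + b\<^sup>2 * ((1 - s) * (3 + s)) \<le> 3 * b\<^sup>2"
proof -
  have "t * s\<^sup>2 \<le> 3 * b\<^sup>2 * s\<^sup>2" using assms by (intro mult_right_mono) simp_all
  moreover have "2 * b * q * (s * (1 - s)) \<le> 2 * b * b * (s * (1 - s))"
    using assms by (intro mult_right_mono mult_left_mono) simp_all
  ultimately show ?thesis by (simp add: algebra_simps power2_eq_square)
qed

text \<open>
  The slack is \<open>1 - s\<close> times an affine function of \<open>s\<close> with the values \<open>t - 3 b\<^sup>2\<close> at \<open>0\<close> and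
  \<open>2 (t - b q - 2 b\<^sup>2)\<close> at \<open>1\<close>. Each alternative makes both values nonnegative.
\<close>

lemma quadratic_le_at_1:
  fixes b t q s :: real
  assumes "b > 0" "0 \<le> s" "s \<le> 1"
    and "b \<le> q \<and> b * q + 2 * b\<^sup>2 \<le> t \<or> q \<le> b \<and> 3 * b\<^sup>2 \<le> t"
  shows "t * s\<^sup>2 + 2 * b * q * (s * (1 - s)) + b\<^sup>2 * ((1 - s) * (3 + s)) \<le> t"
proof -
  have "2 * b * q * s + b\<^sup>2 * (3 + s) \<le> t * (1 + s)"
    using assms(4)
  proof
    assume *: "b \<le> q \<and> b * q + 2 * b\<^sup>2 \<le> t"
    have "0 \<le> b * (q - b) * (1 - s)" using * assms by simp
    then have "2 * b * q * s + b\<^sup>2 * (3 + s) \<le> (b * q + 2 * b\<^sup>2) * (1 + s)"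
      by (simp add: algebra_simps power2_eq_square)
    also have "\<dots> \<le> t * (1 + s)" using * assms by (intro mult_right_mono) simp_all
    finally show ?thesis .
  next
    assume *: "q \<le> b \<and> 3 * b\<^sup>2 \<le> t"
    have "0 \<le> 2 * b * (b - q) * s" using * assms by simp
    then have "2 * b * q * s + b\<^sup>2 * (3 + s) \<le> 3 * b\<^sup>2 * (1 + s)"
      by (simp add: algebra_simps power2_eq_square)
    also have "\<dots> \<le> t * (1 + s)" using * assms by (intro mult_right_mono) simp_all
    finally show ?thesis .
  qed
  from mult_right_mono[OF this, of "1 - s"] assms show ?thesis
    by (simp add: algebra_simps power2_eq_square)
qed

text \<open>
  The leading coefficient is at most \<open>b (b - q) < 0\<close>, so completing the square bounds the
  quadratic by the value at its vertex.
\<close>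

lemma quadratic_le_at_vertex:
  fixes b t q s :: real
  assumes "b > 0" "b < q" "t \<le> b * q + 2 * b\<^sup>2"
  shows "t * s\<^sup>2 + 2 * b * q * (s * (1 - s)) + b\<^sup>2 * ((1 - s) * (3 + s))
      \<le> b\<^sup>2 * ((3 * t - 4 * b * q - q\<^sup>2 - 4 * b\<^sup>2) / (t - 2 * b * q - b\<^sup>2))"
proof -
  define m where "m = t - 2 * b * q - b\<^sup>2"
  have "b * b < b * q" using assms by simp
  then have m: "m < 0" using assms(3) by (simp add: m_def power2_eq_square algebra_simps)
  have "b\<^sup>2 * ((3 * t - 4 * b * q - q\<^sup>2 - 4 * b\<^sup>2) / m)
      - (t * s\<^sup>2 + 2 * b * q * (s * (1 - s)) + b\<^sup>2 * ((1 - s) * (3 + s)))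
    = - (m * s + b * (q - b))\<^sup>2 / m"
    using m by (simp add: field_simps) (simp add: m_def, algebra)
  also have "\<dots> \<ge> 0" using m by (intro divide_nonpos_neg) simp_all
  finally show ?thesis by (simp add: m_def)
qed

section \<open>The Hankel determinant of the inverse\<close>

theorem theorem3p1:
  fixes \<phi> f g :: "complex \<Rightarrow> complex" and B :: "nat \<Rightarrow> real" and A :: "nat \<Rightarrow> complex" and r :: real
  assumes phi: "ma_minda \<phi>"
    and phi_series:
      "\<And>z. z \<in> unit_disc \<Longrightarrow> (\<lambda>n. complex_of_real (B (n + 1)) * z ^ (n + 1)) sums (\<phi> z - 1)"
    and f: "f \<in> starlike_class \<phi>"
    and g: "local_inverse_at_0 f g"
    and r: "r > 0"
    and g_series: "\<And>w. w \<in> ball 0 r \<Longrightarrow> (\<lambda>n. A (n + 2) * w ^ (n + 2)) sums (g w - w)"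
  shows
    "(\<bar>3 * (B 1)^2 - B 2\<bar> \<le> B 1 \<and>
      \<bar>5 * (B 1)^4 - 6 * (B 1)^2 * B 2 - 3 * (B 2)^2 + 4 * B 1 * B 3\<bar> - 3 * (B 1)^2 \<le> 0
      \<longrightarrow> cmod (A 2 * A 4 - (A 3)^2) \<le> (B 1)^2 / 4)
   \<and> (\<bar>3 * (B 1)^2 - B 2\<bar> \<ge> B 1 \<and>
      \<bar>5 * (B 1)^4 - 6 * (B 1)^2 * B 2 - 3 * (B 2)^2 + 4 * B 1 * B 3\<bar>
        - B 1 * \<bar>3 * (B 1)^2 - B 2\<bar> - 2 * (B 1)^2 \<ge> 0
      \<or> \<bar>3 * (B 1)^2 - B 2\<bar> \<le> B 1 \<and>
      \<bar>5 * (B 1)^4 - 6 * (B 1)^2 * B 2 - 3 * (B 2)^2 + 4 * B 1 * B 3\<bar> - 3 * (B 1)^2 \<ge> 0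
      \<longrightarrow> cmod (A 2 * A 4 - (A 3)^2)
            \<le> 1 / 12 * \<bar>5 * (B 1)^4 - 6 * (B 1)^2 * B 2 - 3 * (B 2)^2 + 4 * B 1 * B 3\<bar>)
   \<and> (\<bar>3 * (B 1)^2 - B 2\<bar> > B 1 \<and>
      \<bar>5 * (B 1)^4 - 6 * (B 1)^2 * B 2 - 3 * (B 2)^2 + 4 * B 1 * B 3\<bar>
        - B 1 * \<bar>3 * (B 1)^2 - B 2\<bar> - 2 * (B 1)^2 \<le> 0
      \<longrightarrow> cmod (A 2 * A 4 - (A 3)^2)
            \<le> (B 1)^2 / 12 *
              ((3 * \<bar>5 * (B 1)^4 - 6 * (B 1)^2 * B 2 - 3 * (B 2)^2 + 4 * B 1 * B 3\<bar>
                  - 4 * B 1 * \<bar>3 * (B 1)^2 - B 2\<bar> - (3 * (B 1)^2 - B 2)^2 - 4 * (B 1)^2)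
               / (\<bar>5 * (B 1)^4 - 6 * (B 1)^2 * B 2 - 3 * (B 2)^2 + 4 * B 1 * B 3\<bar>
                  - 2 * B 1 * \<bar>3 * (B 1)^2 - B 2\<bar> - (B 1)^2)))"
proof -
  define T Q where "T = 5 * (B 1)^4 - 6 * (B 1)^2 * B 2 - 3 * (B 2)^2 + 4 * B 1 * B 3"
    and "Q = 3 * (B 1)^2 - B 2"
  define \<Phi> where "\<Phi> = Abs_fps (\<lambda>n. if n = 0 then 1 else complex_of_real (B n))"
  define G where "G = Abs_fps (\<lambda>n. if n = 0 then 0 else if n = 1 then 1 else A n)"

  have \<Phi>: "\<phi> has_fps_expansion \<Phi>"
  proof (rule has_fps_expansionI)
    show "\<forall>\<^sub>F z in nhds 0. (\<lambda>n. \<Phi> $ n * z ^ n) sums \<phi> z"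
      using eventually_norm_less_1
    proof eventually_elim
      case (elim z)
      then have "(\<lambda>n. \<Phi> $ Suc n * z ^ Suc n) sums (\<phi> z - 1)"
        using phi_series[of z] by (simp add: \<Phi>_def)
      then show ?case
        using sums_Suc_iff[of "\<lambda>n. \<Phi> $ n * z ^ n" "\<phi> z - 1"] by (simp add: \<Phi>_def)
    qed
  qed
  have G: "g has_fps_expansion G"
  proof (rule has_fps_expansionI)
    have "\<forall>\<^sub>F z in nhds (0::complex). z \<in> ball 0 r"
      using r by (intro eventually_nhds_in_open) auto
    then show "\<forall>\<^sub>F z in nhds 0. (\<lambda>n. G $ n * z ^ n) sums g z"
    proof eventually_elim
      case (elim z)
      then have "(\<lambda>n. G $ (n + 2) * z ^ (n + 2)) sums (g z - z)"
        using g_series[of z] by (simp add: G_def)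
      then show ?case
        using sums_iff_shift[of "\<lambda>n. G $ n * z ^ n" 2 "g z - z"]
        by (simp add: G_def eval_nat_numeral)
    qed
  qed

  from f obtain w where f_holo: "f holomorphic_on unit_disc" and f0: "f 0 = 0" "deriv f 0 = 1"
    and w: "w holomorphic_on unit_disc" "w ` unit_disc \<subseteq> unit_disc" "w 0 = 0"
    and sub: "\<And>z. z \<in> unit_disc \<Longrightarrow> (if z = 0 then 1 else z * deriv f z / f z) = \<phi> (w z)"
    by (auto simp: starlike_class_def class_A_def subordinate_def)
  have w_lt1: "norm (w z) < 1" if "norm z < 1" for z
    using w(2) that by (simp add: image_subset_iff)
  define F W where "F = fps_expansion f 0" and "W = fps_expansion w 0"
  have F: "f has_fps_expansion F" and W: "w has_fps_expansion W"
    unfolding F_def W_def using f_holo w(1)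
    by (auto intro!: has_fps_expansion_fps_expansion[of unit_disc])
  have F_nth: "F $ 0 = 0" "F $ 1 = 1"
    using fps_nth_fps_expansion[OF F] f0 by simp_all
  have W0: "W $ 0 = 0" using fps_nth_fps_expansion[OF W] w(3) by simp
  have G0: "G $ 0 = 0" by (simp add: G_def)

  \<comment> \<open>If \<open>f z = 0\<close>, the quotient \<open>z * deriv f z / f z\<close> is \<open>0\<close>, but \<open>\<phi> (w z)\<close> has positive real part.\<close>
  have ode: "z * deriv f z = f z * (\<phi> \<circ> w) z" if z: "norm z < 1" for z
  proof (cases "z = 0")
    case False
    have "\<phi> (w z) \<noteq> 0" using phi w_lt1[OF z] by (force simp: ma_minda_def)
    moreover have "z * deriv f z / f z = \<phi> (w z)" using sub[of z] z False by simp
    ultimately have "f z \<noteq> 0" "z * deriv f z / f z = (\<phi> \<circ> w) z" by auto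
    then show ?thesis by (simp add: nonzero_divide_eq_eq mult.commute)
  qed (use f0 in simp)
  have "fps_X * fps_deriv F = F * (\<Phi> oo W)"
  proof (rule fps_expansion_eqI_eventually)
    show "(\<lambda>z. z * deriv f z) has_fps_expansion fps_X * fps_deriv F"
      by (intro fps_expansion_intros F)
    show "(\<lambda>z. f z * (\<phi> \<circ> w) z) has_fps_expansion F * (\<Phi> oo W)"
      by (intro has_fps_expansion_mult has_fps_expansion_compose F \<Phi> W W0)
    show "\<forall>\<^sub>F z in nhds 0. z * deriv f z = f z * (\<phi> \<circ> w) z"
      using eventually_norm_less_1 by eventually_elim (rule ode)
  qed
  moreover have "F oo G = fps_X"
  proof (rule fps_expansion_eqI_eventually)
    show "(f \<circ> g) has_fps_expansion (F oo G)" by (intro has_fps_expansion_compose F G G0)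
    show "(\<lambda>z. z) has_fps_expansion fps_X" by (rule has_fps_expansion_fps_X)
    show "\<forall>\<^sub>F z in nhds 0. (f \<circ> g) z = z" using g by (simp add: local_inverse_at_0_def)
  qed
  ultimately have hankel: "12 * (A 2 * A 4 - (A 3)\<^sup>2) =
      of_real T * (W $ 1) ^ 4 - 2 * of_real (B 1) * of_real Q * (W $ 1)\<^sup>2 * W $ 2
      + 4 * (of_real (B 1))\<^sup>2 * W $ 1 * W $ 3 - 3 * (of_real (B 1))\<^sup>2 * (W $ 2)\<^sup>2"
    using inverse_hankel_determinant[of F \<Phi> W G] F_nth W0 G0
    by (simp add: \<Phi>_def G_def T_def Q_def)

  have "complex_of_real (B 1) = deriv \<phi> 0"
    using fps_nth_fps_expansion[OF \<Phi>, of 1] by (simp add: \<Phi>_def)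
  then have B1: "B 1 > 0" using phi by (metis Re_complex_of_real ma_minda_def)

  obtain x y where xy: "norm (W $ 1) \<le> 1" "norm x \<le> 1" "norm y \<le> 1"
    "W $ 2 = complex_of_real (1 - (cmod (W $ 1))\<^sup>2) * x"
    "W $ 3 = complex_of_real (1 - (cmod (W $ 1))\<^sup>2) *
        (complex_of_real (1 - (cmod x)\<^sup>2) * y - cnj (W $ 1) * x\<^sup>2)"
    by (rule schwarz_function_coefficients[OF w(1,3) w_lt1 W])
  define s where "s = (cmod (W $ 1))\<^sup>2"
  have s: "0 \<le> s" "s \<le> 1" using xy(1) by (simp_all add: s_def power_le_one)
  have "12 * cmod (A 2 * A 4 - (A 3)\<^sup>2) = cmod (12 * (A 2 * A 4 - (A 3)\<^sup>2))"
    by (simp only: norm_mult norm_numeral)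
  also have "\<dots> \<le> \<bar>T\<bar> * s\<^sup>2 + 2 * B 1 * \<bar>Q\<bar> * (s * (1 - s)) + (B 1)\<^sup>2 * ((1 - s) * (3 + s))"
    unfolding hankel s_def by (rule hankel_quadratic_bound[OF less_imp_le[OF B1] xy])
  finally have bound: "12 * cmod (A 2 * A 4 - (A 3)\<^sup>2)
    \<le> \<bar>T\<bar> * s\<^sup>2 + 2 * B 1 * \<bar>Q\<bar> * (s * (1 - s)) + (B 1)\<^sup>2 * ((1 - s) * (3 + s))" .
  show ?thesis
    unfolding T_def[symmetric] Q_def[symmetric]
  proof (intro conjI impI)
    assume "\<bar>Q\<bar> \<le> B 1 \<and> \<bar>T\<bar> - 3 * (B 1)\<^sup>2 \<le> 0"
    then show "cmod (A 2 * A 4 - (A 3)\<^sup>2) \<le> (B 1)\<^sup>2 / 4"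
      using bound quadratic_le_at_0[OF B1 s, of "\<bar>Q\<bar>" "\<bar>T\<bar>"] by simp
  next
    assume "\<bar>Q\<bar> \<ge> B 1 \<and> \<bar>T\<bar> - B 1 * \<bar>Q\<bar> - 2 * (B 1)\<^sup>2 \<ge> 0
      \<or> \<bar>Q\<bar> \<le> B 1 \<and> \<bar>T\<bar> - 3 * (B 1)\<^sup>2 \<ge> 0"
    then show "cmod (A 2 * A 4 - (A 3)\<^sup>2) \<le> 1 / 12 * \<bar>T\<bar>"
      using bound quadratic_le_at_1[OF B1 s, of "\<bar>Q\<bar>" "\<bar>T\<bar>"] by force
  next
    assume *: "\<bar>Q\<bar> > B 1 \<and> \<bar>T\<bar> - B 1 * \<bar>Q\<bar> - 2 * (B 1)\<^sup>2 \<le> 0"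
    define R where "R = (3 * \<bar>T\<bar> - 4 * B 1 * \<bar>Q\<bar> - Q\<^sup>2 - 4 * (B 1)\<^sup>2)
        / (\<bar>T\<bar> - 2 * B 1 * \<bar>Q\<bar> - (B 1)\<^sup>2)"
    have "12 * cmod (A 2 * A 4 - (A 3)\<^sup>2) \<le> (B 1)\<^sup>2 * R"
      using bound quadratic_le_at_vertex[OF B1, of "\<bar>Q\<bar>" "\<bar>T\<bar>" s] *
      unfolding R_def power2_abs by linarith
    then have "cmod (A 2 * A 4 - (A 3)\<^sup>2) \<le> (B 1)\<^sup>2 / 12 * R" by simp
    then show "cmod (A 2 * A 4 - (A 3)\<^sup>2) \<le> (B 1)\<^sup>2 / 12 *
        ((3 * \<bar>T\<bar> - 4 * B 1 * \<bar>Q\<bar> - Q\<^sup>2 - 4 * (B 1)\<^sup>2) / (\<bar>T\<bar> - 2 * B 1 * \<bar>Q\<bar> - (B 1)\<^sup>2))"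
      unfolding R_def .
  qed
qed

end
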